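(* Let $M\colon G(m,n)\to\mathbf{Vec}$ be a persistence module and let $\mu$ be a barcode basis of $M$. Then $PM\big(\mathcal{GC}_\mu(M)\big)\cong M$.
   Context: $G(m,n)$ is the poset $\{1,\ldots,m\}\times\{1,\ldots,n\}$ with the product order. A persistence module is a functor $M\colon G(m,n)\to\mathbf{Vec}$ into finite-dimensional vector spaces over $\mathbb{Z}_2$; morphisms are natural transformations. Fixing the second coordinate to $i$ gives the slice $M_{(-,i)}\colon G(m,1)\to\mathbf{Vec}$; the maps of $M$ from second coordinate $i$ to $i+1$ form a morphism $M_{(-,i)}^{(-,i+1)}\colon M_{(-,i)}\to M_{(-,i+1)}$, and in this way a two-parameter module is the same as a sequence of one-parameter modules with connecting morphisms. For integers $1\le b<d\le m+1$, the one-parameter interval module $[b,d)\colon G(m,1)\to\mathbf{Vec}$ is $\mathbb{Z}_2$ at all $x$ with $b\le x<d$, zero elsewhere, with identity maps inside the interval. For intervals $I=[b_1,d_1)$, $J=[b_2,d_2)$ write $J\lhd I$ if $b_2\le b_1<d_2\le d_1$. Then $\mathrm{Hom}(I,J)\cong\mathbb{Z}_2$ if $J\lhd I$ and $0$ otherwise; so there is at most one non-zero morphism $I\to J$, denoted $1$, and morphisms between direct sums of intervals are described by matrices over $\mathbb{Z}_2$ (rows indexed by target summands, columns by source summands). A graphcode is a directed graph $\mathcal{G}=(V,E,c)$ with vertex labels $c\colon V\to\{1,\ldots,m\}\times\{1,\ldots,m+1\}\times\{1,\ldots,n\}$, $c(v)=(b(v),d(v),h(v))$, such that (1) $b(v)<d(v)$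 for all $v\in V$; (2) for every edge $(v,w)\in E$, $h(w)=h(v)+1$ and $[b(w),d(w))\lhd[b(v),d(v))$. The induced module $PM(\mathcal{G})$ has slices $PM(\mathcal{G})_{(-,i)}=\bigoplus_{v:\,h(v)=i}[b(v),d(v))$ and connecting morphism from slice $i$ to $i+1$ given by the matrix with entry $1$ at (row $w$, column $v$) if $(v,w)\in E$ and $0$ otherwise, where $h(v)=i$, $h(w)=i+1$. A barcode basis of $M$ is a tuple $\mu=(\mu_1,\ldots,\mu_n)$ of isomorphisms $\mu_i\colon M_{(-,i)}\to\bigoplus_{k=1}^{s_i}I^i_k$ onto direct sums of one-parameter interval modules. It yields an isomorphic module $M_\mu$ with slices $\bigoplus_{k=1}^{s_i}I^i_k$ and connecting morphisms $\eta^i=\mu_{i+1}\circ M_{(-,i)}^{(-,i+1)}\circ\mu_i^{-1}$, viewed as matrices $(\eta^i_{lk})$ over $\mathbb{Z}_2$. The graphcode $\mathcal{GC}_\mu(M)$ has one vertex for each summand $I^i_k=[b,d)$ ($1\le i\le n$, $1\le k\le s_i$), with label $(b,d,i)$, and an edge $(I^i_k,I^{i+1}_l)$ exactly when $\eta^i_{lk}=1$. *)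

theory Defs
  imports "HOL-Library.Z2" "HOL-Library.Function_Algebras" "HOL-Library.Product_Order"
    "Graph_Theory.Pair_Digraph"
begin

section \<open>Vector spaces over the field with two elements\<close>

text \<open>
  The field \<open>\<int>\<^sub>2\<close> is the type \<^typ>\<open>bit\<close>. The types of the following class are the vector
  spaces over \<open>\<int>\<^sub>2\<close>, of arbitrary dimension. The spaces of a persistence module are
  finite-dimensional subspaces of one such type; this is no restriction, since any family of
  vector spaces embeds into its direct sum.
\<close>

class bit_vector_space = ab_group_add +
  fixes scaleB :: "bit \<Rightarrow> 'a \<Rightarrow> 'a"  (infixr \<open>*\<^sub>B\<close> 75)
  assumes scaleB_add_right: "a *\<^sub>B (x + y) = a *\<^sub>B x + a *\<^sub>B y"
    and scaleB_add_left: "(a + b) *\<^sub>B x = a *\<^sub>B x + b *\<^sub>B x"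
    and scaleB_scaleB: "a *\<^sub>B b *\<^sub>B x = (a * b) *\<^sub>B x"
    and scaleB_one: "1 *\<^sub>B x = x"

global_interpretation bv: vector_space "scaleB :: bit \<Rightarrow> 'a \<Rightarrow> 'a::bit_vector_space"
  by unfold_locales (rule scaleB_add_right scaleB_add_left scaleB_scaleB scaleB_one)+

instantiation bit :: bit_vector_space
begin

definition scaleB_bit :: "bit \<Rightarrow> bit \<Rightarrow> bit" where "scaleB_bit a x = a * x"

instance
  by standard
    (simp_all only: scaleB_bit_def distrib_left distrib_right mult.assoc mult_1)

end

instantiation "fun" :: (type, bit_vector_space) bit_vector_space
begin

definition scaleB_fun :: "bit \<Rightarrow> ('a \<Rightarrow> 'b) \<Rightarrow> 'a \<Rightarrow> 'b"
  where "scaleB_fun a f = (\<lambda>x. a *\<^sub>B f x)"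

instance
  by standard
    (simp_all only: scaleB_fun_def plus_fun_apply fun_eq_iff
      scaleB_add_right scaleB_add_left scaleB_scaleB scaleB_one simp_thms)

end

definition linear_between ::
  "'a::bit_vector_space set \<Rightarrow> 'b::bit_vector_space set \<Rightarrow> ('a \<Rightarrow> 'b) \<Rightarrow> bool"
  where "linear_between A B f \<longleftrightarrow>
    f ` A \<subseteq> B \<and>
    (\<forall>x\<in>A. \<forall>y\<in>A. f (x + y) = f x + f y) \<and>
    (\<forall>c. \<forall>x\<in>A. f (c *\<^sub>B x) = c *\<^sub>B f x)"


section \<open>Persistence modules\<close>

text \<open>Only the values of \<open>spc\<close> and \<open>trn\<close> on the indexing poset, and of \<open>trn p q\<close> for \<open>p \<le> q\<close> on
  the space at \<open>p\<close>, are meaningful. The same remark applies to morphisms.\<close>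

record ('p, 'a) pmodule =
  spc :: "'p \<Rightarrow> 'a set"
  trn :: "'p \<Rightarrow> 'p \<Rightarrow> 'a \<Rightarrow> 'a"

locale persistence_module =
  fixes P :: "'p::order set" and M :: "('p, 'a::bit_vector_space) pmodule"
  assumes subspace: "p \<in> P \<Longrightarrow> bv.subspace (spc M p)"
    and finite_dim: "p \<in> P \<Longrightarrow> \<exists>B. finite B \<and> bv.span B = spc M p"
    and linear: "\<lbrakk>p \<in> P; q \<in> P; p \<le> q\<rbrakk> \<Longrightarrow> linear_between (spc M p) (spc M q) (trn M p q)"
    and trn_id: "\<lbrakk>p \<in> P; v \<in> spc M p\<rbrakk> \<Longrightarrow> trn M p p v = v"
    and trn_comp: "\<lbrakk>p \<in> P; q \<in> P; r \<in> P; p \<le> q; q \<le> r; v \<in> spc M p\<rbrakk>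
      \<Longrightarrow> trn M q r (trn M p q v) = trn M p r v"

locale pm_morphism =
  source: persistence_module P M + target: persistence_module P N
  for P :: "'p::order set"
    and M :: "('p, 'a::bit_vector_space) pmodule"
    and N :: "('p, 'b::bit_vector_space) pmodule" +
  fixes \<phi> :: "'p \<Rightarrow> 'a \<Rightarrow> 'b"
  assumes linear: "p \<in> P \<Longrightarrow> linear_between (spc M p) (spc N p) (\<phi> p)"
    and natural: "\<lbrakk>p \<in> P; q \<in> P; p \<le> q; v \<in> spc M p\<rbrakk>
      \<Longrightarrow> \<phi> q (trn M p q v) = trn N p q (\<phi> p v)"

definition pm_isomorphism where
  "pm_isomorphism P M N \<phi> \<longleftrightarrow> pm_morphism P M N \<phi> \<and>
    (\<exists>\<psi>. pm_morphism P N M \<psi> \<and>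
      (\<forall>p\<in>P. \<forall>v\<in>spc M p. \<psi> p (\<phi> p v) = v) \<and>
      (\<forall>p\<in>P. \<forall>w\<in>spc N p. \<phi> p (\<psi> p w) = w))"

definition pm_isomorphic where
  "pm_isomorphic P M N \<longleftrightarrow> (\<exists>\<phi>. pm_isomorphism P M N \<phi>)"

definition pm_nonzero where
  "pm_nonzero P M \<phi> \<longleftrightarrow> (\<exists>p\<in>P. \<exists>v\<in>spc M p. \<phi> p v \<noteq> 0)"

text \<open>The direct sum of a finite family \<open>(N k)\<^sub>k\<^sub>\<in>\<^sub>K\<close>; its elements are families supported on \<open>K\<close>.\<close>

definition direct_sum ::
  "'k set \<Rightarrow> ('k \<Rightarrow> ('p, 'a::bit_vector_space) pmodule) \<Rightarrow> ('p, 'k \<Rightarrow> 'a) pmodule"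
  where "direct_sum K N = \<lparr>
    spc = (\<lambda>p. {f. \<forall>k. if k \<in> K then f k \<in> spc (N k) p else f k = 0}),
    trn = (\<lambda>p q f k. if k \<in> K then trn (N k) p q (f k) else 0)\<rparr>"


section \<open>Grids and slices\<close>

text \<open>The order on \<^typ>\<open>nat \<times> nat\<close> is the product order.\<close>

definition grid :: "nat \<Rightarrow> nat \<Rightarrow> (nat \<times> nat) set"
  where "grid m n = {1..m} \<times> {1..n}"

definition slice :: "nat \<Rightarrow> (nat \<times> nat, 'a) pmodule \<Rightarrow> (nat \<times> nat, 'a) pmodule"
  where "slice i M = \<lparr>
    spc = (\<lambda>p. spc M (fst p, i)),
    trn = (\<lambda>p q. trn M (fst p, i) (fst q, i))\<rparr>"

definition slice_map :: "nat \<Rightarrow> (nat \<times> nat, 'a) pmodule \<Rightarrow> nat \<times> nat \<Rightarrow> 'a \<Rightarrow> 'a"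
  where "slice_map i M p = trn M (fst p, i) (fst p, Suc i)"

text \<open>
  The two-parameter module with slices \<open>N i\<close> and connecting morphisms \<open>\<eta> i : N i \<rightarrow> N (i + 1)\<close>. Its
  map from \<open>(x, i)\<close> to \<open>(y, j)\<close> is \<open>\<eta> (j - 1) \<circ> \<dots> \<circ> \<eta> i\<close> at \<open>y\<close> after the map of \<open>N i\<close> from \<open>x\<close> to \<open>y\<close>.
\<close>

definition from_slices ::
  "(nat \<Rightarrow> (nat \<times> nat, 'a) pmodule) \<Rightarrow> (nat \<Rightarrow> nat \<times> nat \<Rightarrow> 'a \<Rightarrow> 'a)
    \<Rightarrow> (nat \<times> nat, 'a) pmodule"
  where "from_slices N \<eta> = \<lparr>
    spc = (\<lambda>(x, i). spc (N i) (x, 1)),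
    trn = (\<lambda>(x, i) (y, j) v. fold (\<lambda>l. \<eta> l (y, 1)) [i..<j] (trn (N i) (x, 1) (y, 1) v))\<rparr>"


section \<open>Interval modules and their morphisms\<close>

text \<open>The pair \<open>(b, d)\<close> stands for the interval \<open>[b, d)\<close>.\<close>

type_synonym intvl = "nat \<times> nat"

definition valid_intvl :: "nat \<Rightarrow> intvl \<Rightarrow> bool"
  where "valid_intvl m I \<longleftrightarrow> 1 \<le> fst I \<and> fst I < snd I \<and> snd I \<le> m + 1"

definition in_intvl :: "nat \<times> nat \<Rightarrow> intvl \<Rightarrow> bool"
  where "in_intvl p I \<longleftrightarrow> fst I \<le> fst p \<and> fst p < snd I"

definition interval_module :: "intvl \<Rightarrow> (nat \<times> nat, bit) pmodule"
  where "interval_module I = \<lparr>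
    spc = (\<lambda>p. if in_intvl p I then UNIV else {0}),
    trn = (\<lambda>p q a. if in_intvl p I \<and> in_intvl q I then a else 0)\<rparr>"

definition intvl_rel :: "intvl \<Rightarrow> intvl \<Rightarrow> bool"  (infix \<open>\<lhd>\<^sub>I\<close> 50)
  where "J \<lhd>\<^sub>I I \<longleftrightarrow> fst J \<le> fst I \<and> fst I < snd J \<and> snd J \<le> snd I"

text \<open>For \<open>J \<lhd>\<^sub>I I\<close>, the unique non-zero morphism from \<open>I\<close> to \<open>J\<close>.\<close>

definition interval_one :: "intvl \<Rightarrow> intvl \<Rightarrow> nat \<times> nat \<Rightarrow> bit \<Rightarrow> bit"
  where "interval_one I J p a = (if in_intvl p I \<and> in_intvl p J then a else 0)"

text \<open>
  The map from the direct sum of the \<open>I k\<close> (\<open>k \<in> K\<close>) to that of the \<open>J l\<close> (\<open>l \<in> L\<close>) described by the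
  matrix \<open>A\<close>, the first index of \<open>A\<close> being the row.
\<close>

definition matrix_map ::
  "'k set \<Rightarrow> ('k \<Rightarrow> intvl) \<Rightarrow> 'l set \<Rightarrow> ('l \<Rightarrow> intvl) \<Rightarrow> ('l \<Rightarrow> 'k \<Rightarrow> bit)
    \<Rightarrow> nat \<times> nat \<Rightarrow> ('k \<Rightarrow> bit) \<Rightarrow> 'l \<Rightarrow> bit"
  where "matrix_map K I L J A p f =
    (\<lambda>l. if l \<in> L then \<Sum>k\<in>K. A l k * interval_one (I k) (J l) p (f k) else 0)"

text \<open>
  Conversely, the \<open>(l, k)\<close> component \<open>I k \<rightarrow> J l\<close> of a morphism of direct sums, and the matrix entry
  it corresponds to: \<open>1\<close> if the component is the non-zero morphism and \<open>0\<close> otherwise.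
\<close>

definition component ::
  "(nat \<times> nat \<Rightarrow> ('k \<Rightarrow> bit) \<Rightarrow> 'l \<Rightarrow> bit) \<Rightarrow> 'l \<Rightarrow> 'k \<Rightarrow> nat \<times> nat \<Rightarrow> bit \<Rightarrow> bit"
  where "component \<eta> l k p a = \<eta> p (\<lambda>k'. if k' = k then a else 0) l"

definition matrix_entry ::
  "nat \<Rightarrow> ('k \<Rightarrow> intvl) \<Rightarrow> (nat \<times> nat \<Rightarrow> ('k \<Rightarrow> bit) \<Rightarrow> 'l \<Rightarrow> bit) \<Rightarrow> 'l \<Rightarrow> 'k \<Rightarrow> bit"
  where "matrix_entry m I \<eta> l k =
    of_bool (pm_nonzero (grid m 1) (interval_module (I k)) (component \<eta> l k))"


section \<open>Graphcodes\<close>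

record 'v graphcode =
  gc_graph :: "'v pair_pre_digraph"
  gc_label :: "'v \<Rightarrow> nat \<times> nat \<times> nat"

definition gc_intvl :: "'v graphcode \<Rightarrow> 'v \<Rightarrow> intvl"
  where "gc_intvl G v = (case gc_label G v of (b, d, h) \<Rightarrow> (b, d))"

definition gc_height :: "'v graphcode \<Rightarrow> 'v \<Rightarrow> nat"
  where "gc_height G v = (case gc_label G v of (b, d, h) \<Rightarrow> h)"

locale graphcode =
  fixes m n :: nat and G :: "'v graphcode"
  assumes digraph: "pair_fin_digraph (gc_graph G)"
    and label: "v \<in> pverts (gc_graph G) \<Longrightarrow> gc_label G v \<in> {1..m} \<times> {1..m + 1} \<times> {1..n}"
    and birth_less_death: "v \<in> pverts (gc_graph G) \<Longrightarrow> fst (gc_intvl G v) < snd (gc_intvl G v)"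
    and arc_height: "(v, w) \<in> parcs (gc_graph G) \<Longrightarrow> gc_height G w = gc_height G v + 1"
    and arc_intvl: "(v, w) \<in> parcs (gc_graph G) \<Longrightarrow> gc_intvl G w \<lhd>\<^sub>I gc_intvl G v"

definition gc_level :: "'v graphcode \<Rightarrow> nat \<Rightarrow> 'v set"
  where "gc_level G i = {v \<in> pverts (gc_graph G). gc_height G v = i}"

definition PM :: "'v graphcode \<Rightarrow> (nat \<times> nat, 'v \<Rightarrow> bit) pmodule"
  where "PM G = from_slices
    (\<lambda>i. direct_sum (gc_level G i) (\<lambda>v. interval_module (gc_intvl G v)))
    (\<lambda>i. matrix_map (gc_level G i) (gc_intvl G) (gc_level G (Suc i)) (gc_intvl G)
      (\<lambda>w v. of_bool ((v, w) \<in> parcs (gc_graph G))))"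


section \<open>Barcode bases\<close>

text \<open>
  \<open>bb_num \<mu> i\<close> is the number of summands in the decomposition of the \<open>i\<close>-th slice, \<open>bb_intvl \<mu> i k\<close> the
  \<open>k\<close>-th of these intervals and \<open>bb_iso \<mu> i\<close> the isomorphism from the slice to their direct sum.
\<close>

record 'a barcode_basis =
  bb_num :: "nat \<Rightarrow> nat"
  bb_intvl :: "nat \<Rightarrow> nat \<Rightarrow> intvl"
  bb_iso :: "nat \<Rightarrow> nat \<times> nat \<Rightarrow> 'a \<Rightarrow> nat \<Rightarrow> bit"

definition bb_slice :: "'a barcode_basis \<Rightarrow> nat \<Rightarrow> (nat \<times> nat, nat \<Rightarrow> bit) pmodule"
  where "bb_slice \<mu> i = direct_sum {1..bb_num \<mu> i} (\<lambda>k. interval_module (bb_intvl \<mu> i k))"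

definition barcode_basis ::
  "nat \<Rightarrow> nat \<Rightarrow> (nat \<times> nat, 'a::bit_vector_space) pmodule \<Rightarrow> 'a barcode_basis \<Rightarrow> bool"
  where "barcode_basis m n M \<mu> \<longleftrightarrow> (\<forall>i\<in>{1..n}.
    (\<forall>k\<in>{1..bb_num \<mu> i}. valid_intvl m (bb_intvl \<mu> i k)) \<and>
    pm_isomorphism (grid m 1) (slice i M) (bb_slice \<mu> i) (bb_iso \<mu> i))"

definition bb_map ::
  "(nat \<times> nat, 'a) pmodule \<Rightarrow> 'a barcode_basis \<Rightarrow> nat
    \<Rightarrow> nat \<times> nat \<Rightarrow> (nat \<Rightarrow> bit) \<Rightarrow> nat \<Rightarrow> bit"
  where "bb_map M \<mu> i p =
    bb_iso \<mu> (Suc i) p \<circ> slice_map i M p \<circ> inv_into (spc (slice i M) p) (bb_iso \<mu> i p)"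

text \<open>The vertex \<open>(i, k)\<close> is the \<open>k\<close>-th summand of the \<open>i\<close>-th slice.\<close>

definition GC ::
  "nat \<Rightarrow> nat \<Rightarrow> 'a barcode_basis \<Rightarrow> (nat \<times> nat, 'a) pmodule \<Rightarrow> (nat \<times> nat) graphcode"
  where "GC m n \<mu> M = \<lparr>
    gc_graph = \<lparr>
      pverts = {(i, k). i \<in> {1..n} \<and> k \<in> {1..bb_num \<mu> i}},
      parcs = {((i, k), (i + 1, l)) | i k l.
        i \<in> {1..<n} \<and> k \<in> {1..bb_num \<mu> i} \<and> l \<in> {1..bb_num \<mu> (i + 1)} \<and>
        matrix_entry m (bb_intvl \<mu> i) (bb_map M \<mu> i) l k = 1}\<rparr>,
    gc_label = (\<lambda>(i, k). (fst (bb_intvl \<mu> i k), snd (bb_intvl \<mu> i k), i))\<rparr>"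


subsection \<open>Justification of the definitions on intervals and graphcodes\<close>

lemma linear_between_comp:
  assumes "linear_between A B f" "linear_between B C g"
  shows "linear_between A C (g \<circ> f)"
  using assms unfolding linear_between_def
  by (simp add: image_subset_iff)

lemma pm_morphism_comp:
  assumes "pm_morphism P L M \<phi>" "pm_morphism P M N \<psi>"
  shows "pm_morphism P L N (\<lambda>p. \<psi> p \<circ> \<phi> p)"
proof -
  interpret a: pm_morphism P L M \<phi> by fact
  interpret b: pm_morphism P M N \<psi> by fact
  show ?thesis
  proof
    show "linear_between (spc L p) (spc N p) (\<psi> p \<circ> \<phi> p)" if "p \<in> P" for p
      using that a.linear b.linear linear_between_comp by blast
    show "(\<psi> q \<circ> \<phi> q) (trn L p q v) = trn N p q ((\<psi> p \<circ> \<phi> p) v)"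
      if "p \<in> P" "q \<in> P" "p \<le> q" "v \<in> spc L p" for p q v
    proof -
      have "\<phi> p v \<in> spc M p"
        using a.linear[OF that(1)] that(4) by (auto simp: linear_between_def)
      then show ?thesis using that a.natural b.natural by simp
    qed
  qed
qed

lemma linear_between_zero:
  assumes "linear_between A B f" "0 \<in> A"
  shows "f 0 = 0"
proof -
  have "f (0 *\<^sub>B 0) = 0 *\<^sub>B f 0" using assms unfolding linear_between_def by blast
  then show ?thesis by simp
qed

lemma persistence_module_interval:
  "persistence_module (grid m 1) (interval_module I)"
proof
  show "bv.subspace (spc (interval_module I) p)" for p
    by (simp add: interval_module_def bv.subspace_def)
  have "bv.span {1} = (UNIV :: bit set)"
  proof -
    have "x \<in> bv.span {1}" for x :: bit
      by (cases x) (auto simp: bv.span_zero bv.span_base)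
    then show ?thesis by auto
  qed
  moreover have "bv.span {} = {0::bit}" by simp
  ultimately show "\<exists>B. finite B \<and> bv.span B = spc (interval_module I) p" for p
    by (cases "in_intvl p I")
      (auto simp: interval_module_def intro: exI[of _ "{1}"] exI[of _ "{}"])
  show "linear_between (spc (interval_module I) p) (spc (interval_module I) q)
    (trn (interval_module I) p q)" for p q
    by (auto simp: linear_between_def interval_module_def scaleB_bit_def)
  show "trn (interval_module I) p p v = v" if "v \<in> spc (interval_module I) p" for p v
    using that by (auto simp: interval_module_def split: if_splits)
  show "trn (interval_module I) q r (trn (interval_module I) p q v) = trn (interval_module I) p r v"
    if "p \<le> q" "q \<le> r" "v \<in> spc (interval_module I) p" for p q r v
    using that by (auto simp: interval_module_def in_intvl_def less_eq_prod_def split: if_splits)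
qed

lemma interval_one_morphism:
  assumes "J \<lhd>\<^sub>I I"
  shows "pm_morphism (grid m 1) (interval_module I) (interval_module J) (interval_one I J)"
proof (intro pm_morphism.intro persistence_module_interval pm_morphism_axioms.intro)
  show "linear_between (spc (interval_module I) p) (spc (interval_module J) p) (interval_one I J p)"
    for p
    by (auto simp: linear_between_def interval_module_def interval_one_def scaleB_bit_def)
  show "interval_one I J q (trn (interval_module I) p q v) =
      trn (interval_module J) p q (interval_one I J p v)"
    if "p \<le> q" "v \<in> spc (interval_module I) p" for p q v
    using that assms
    by (auto simp: interval_module_def interval_one_def in_intvl_def less_eq_prod_def intvl_rel_def
        split: if_splits)
qed

lemma nonzero_interval_morphism:
  assumes "valid_intvl m I" "valid_intvl m J"
    and "pm_morphism (grid m 1) (interval_module I) (interval_module J) \<phi>"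
    and "pm_nonzero (grid m 1) (interval_module I) \<phi>"
  shows "J \<lhd>\<^sub>I I"
    and "\<lbrakk>p \<in> grid m 1; a \<in> spc (interval_module I) p\<rbrakk> \<Longrightarrow> \<phi> p a = interval_one I J p a"
proof -
  interpret pm_morphism "grid m 1" "interval_module I" "interval_module J" \<phi> by fact
  have 0: "\<phi> q 0 = 0" if "q \<in> grid m 1" for q
    using linear_between_zero[OF linear[OF that]] by (auto simp: interval_module_def)
  have out: "\<phi> q a = 0" if "q \<in> grid m 1" "a \<in> spc (interval_module I) q" "\<not> in_intvl q J" for q a
    using linear[OF that(1)] that by (auto simp: linear_between_def interval_module_def)
  obtain x a where x: "(x, 1) \<in> grid m 1" "a \<in> spc (interval_module I) (x, 1)" "\<phi> (x, 1) a \<noteq> 0"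
    using assms(4) by (auto simp: pm_nonzero_def grid_def)
  then have "a \<noteq> 0" using 0 by metis
  then have one: "\<phi> (x, 1) 1 = 1" and xI: "in_intvl (x, 1) I"
    using x by (auto simp: interval_module_def split: if_splits)
  have xJ: "in_intvl (x, 1) J"
    using out x by blast
  have nat: "\<phi> (z, 1) (trn (interval_module I) (y, 1) (z, 1) 1) =
      trn (interval_module J) (y, 1) (z, 1) (\<phi> (y, 1) 1)"
    if "(y, 1) \<in> grid m 1" "(z, 1) \<in> grid m 1" "y \<le> z" "in_intvl (y, 1) I" for y z
    by (rule natural) (use that in \<open>auto simp: interval_module_def less_eq_prod_def\<close>)
  have 1: "fst J \<le> fst I"
  proof (rule ccontr)
    assume n: "\<not> fst J \<le> fst I"
    show False
      using nat[of "fst I" x] out[of "(fst I, 1)" 1] n one xI x(1) assms(1)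
      by (auto simp: interval_module_def in_intvl_def grid_def valid_intvl_def)
  qed
  have 2: "snd J \<le> snd I"
  proof (rule ccontr)
    assume n: "\<not> snd J \<le> snd I"
    show False
      using nat[of x "snd I"] 0[of "(snd I, 1)"] n one xI xJ x(1) assms(1,2)
      by (auto simp: interval_module_def in_intvl_def grid_def valid_intvl_def)
  qed
  show "J \<lhd>\<^sub>I I"
    using 1 2 xI xJ by (auto simp: intvl_rel_def in_intvl_def)
  show "\<phi> p a = interval_one I J p a" if "p \<in> grid m 1" "a \<in> spc (interval_module I) p" for p a
  proof (cases "in_intvl p I \<and> in_intvl p J \<and> a = 1")
    case True
    obtain y where y: "p = (y, 1)" using \<open>p \<in> grid m 1\<close> by (auto simp: grid_def)
    consider "x \<le> y" | "y \<le> x" by linarith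
    then have "\<phi> (y, 1) 1 = 1"
    proof cases
      case 1
      then show ?thesis using nat[of x y] one xI xJ x(1) True y that(1)
        by (auto simp: interval_module_def)
    next
      case 2
      then show ?thesis using nat[of y x] one xI xJ x(1) True y that(1)
        by (auto simp: interval_module_def split: if_splits)
    qed
    then show ?thesis using True y by (simp add: interval_one_def)
  next
    case False
    then show ?thesis
      using 0[OF that(1)] out[OF that] that(2)
      by (auto simp: interval_one_def interval_module_def split: if_splits)
  qed
qed

lemma persistence_module_slice:
  assumes "persistence_module (grid m n) M" "i \<in> {1..n}"
  shows "persistence_module (grid m 1) (slice i M)"
proof -
  interpret persistence_module "grid m n" M by fact
  have g: "(fst p, i) \<in> grid m n" if "p \<in> grid m 1" for p
    using that assms(2) by (auto simp: grid_def)
  show ?thesis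
    by standard (use subspace finite_dim linear trn_id trn_comp g in
      \<open>auto simp: slice_def less_eq_prod_def\<close>)
qed

lemma slice_map_morphism:
  assumes "persistence_module (grid m n) M" "i \<in> {1..<n}"
  shows "pm_morphism (grid m 1) (slice i M) (slice (Suc i) M) (slice_map i M)"
proof -
  interpret persistence_module "grid m n" M by fact
  have g: "(fst p, i) \<in> grid m n" "(fst p, Suc i) \<in> grid m n" if "p \<in> grid m 1" for p
    using that assms(2) by (auto simp: grid_def)
  show ?thesis
  proof (intro pm_morphism.intro pm_morphism_axioms.intro)
    show "persistence_module (grid m 1) (slice i M)"
      "persistence_module (grid m 1) (slice (Suc i) M)"
      using persistence_module_slice[OF assms(1)] assms(2) by auto
    show "linear_between (spc (slice i M) p) (spc (slice (Suc i) M) p) (slice_map i M p)"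
      if "p \<in> grid m 1" for p
      using linear g[OF that] by (auto simp: slice_def slice_map_def)
    show "slice_map i M q (trn (slice i M) p q v) = trn (slice (Suc i) M) p q (slice_map i M p v)"
      if "p \<in> grid m 1" "q \<in> grid m 1" "p \<le> q" "v \<in> spc (slice i M) p" for p q v
      using trn_comp[OF g(1)[OF that(1)] g(1)[OF that(2)] g(2)[OF that(2)]]
        trn_comp[OF g(1)[OF that(1)] g(2)[OF that(1)] g(2)[OF that(2)]] that
      by (auto simp: slice_def slice_map_def less_eq_prod_def)
  qed
qed

lemma pm_morphism_cong:
  assumes "pm_morphism P M N \<phi>" "\<And>p v. \<lbrakk>p \<in> P; v \<in> spc M p\<rbrakk> \<Longrightarrow> \<psi> p v = \<phi> p v"
  shows "pm_morphism P M N \<psi>"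
proof -
  interpret pm_morphism P M N \<phi> by fact
  show ?thesis
  proof
    show "linear_between (spc M p) (spc N p) (\<psi> p)" if "p \<in> P" for p
    proof -
      have "x + y \<in> spc M p" "c *\<^sub>B x \<in> spc M p" if "x \<in> spc M p" "y \<in> spc M p" for x y c
        using source.subspace[OF \<open>p \<in> P\<close>] that
        by (auto simp: bv.subspace_def)
      then show ?thesis
        using linear[OF that] assms(2)[OF that] by (auto simp: linear_between_def)
    qed
    show "\<psi> q (trn M p q v) = trn N p q (\<psi> p v)"
      if "p \<in> P" "q \<in> P" "p \<le> q" "v \<in> spc M p" for p q v
    proof -
      have "trn M p q v \<in> spc M q"
        using source.linear[OF that(1-3)] that(4) by (auto simp: linear_between_def)
      then show ?thesis using that natural assms(2) by simp
    qed
  qed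
qed

lemma bb_map_morphism:
  assumes "persistence_module (grid m n) M" "barcode_basis m n M \<mu>" "i \<in> {1..<n}"
  shows "pm_morphism (grid m 1) (bb_slice \<mu> i) (bb_slice \<mu> (Suc i)) (bb_map M \<mu> i)"
proof -
  have iso: "pm_isomorphism (grid m 1) (slice i M) (bb_slice \<mu> i) (bb_iso \<mu> i)"
    and "pm_isomorphism (grid m 1) (slice (Suc i) M) (bb_slice \<mu> (Suc i)) (bb_iso \<mu> (Suc i))"
    using assms(2,3) by (auto simp: barcode_basis_def)
  then have suc: "pm_morphism (grid m 1) (slice (Suc i) M) (bb_slice \<mu> (Suc i)) (bb_iso \<mu> (Suc i))"
    by (simp add: pm_isomorphism_def)
  obtain \<psi> where \<psi>: "pm_morphism (grid m 1) (bb_slice \<mu> i) (slice i M) \<psi>"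
    "\<And>p v. \<lbrakk>p \<in> grid m 1; v \<in> spc (slice i M) p\<rbrakk> \<Longrightarrow> \<psi> p (bb_iso \<mu> i p v) = v"
    "\<And>p w. \<lbrakk>p \<in> grid m 1; w \<in> spc (bb_slice \<mu> i) p\<rbrakk> \<Longrightarrow> bb_iso \<mu> i p (\<psi> p w) = w"
    using iso unfolding pm_isomorphism_def by blast
  have inv: "inv_into (spc (slice i M) p) (bb_iso \<mu> i p) w = \<psi> p w"
    if "p \<in> grid m 1" "w \<in> spc (bb_slice \<mu> i) p" for p w
  proof (rule inv_into_f_eq)
    show "inj_on (bb_iso \<mu> i p) (spc (slice i M) p)"
      by (rule inj_on_inverseI) (rule \<psi>(2)[OF that(1)])
    show "\<psi> p w \<in> spc (slice i M) p"
      using pm_morphism.linear[OF \<psi>(1) that(1)] that(2) by (auto simp: linear_between_def)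
  qed (use \<psi>(3) that in blast)
  show ?thesis
    by (rule pm_morphism_cong[OF pm_morphism_comp[OF pm_morphism_comp[OF \<psi>(1)
            slice_map_morphism[OF assms(1,3)]] suc]])
      (simp add: bb_map_def inv)
qed

lemma component_morphism:
  assumes "pm_morphism (grid m 1) (direct_sum K (\<lambda>k. interval_module (I k)))
      (direct_sum L (\<lambda>l. interval_module (J l))) \<eta>"
    and "k \<in> K" "l \<in> L"
  shows "pm_morphism (grid m 1) (interval_module (I k)) (interval_module (J l)) (component \<eta> l k)"
proof -
  let ?S = "direct_sum K (\<lambda>k. interval_module (I k))"
  let ?T = "direct_sum L (\<lambda>l. interval_module (J l))"
  interpret \<eta>: pm_morphism "grid m 1" ?S ?T \<eta> by fact
  have incl: "pm_morphism (grid m 1) (interval_module (I k)) ?S (\<lambda>p a k'. if k' = k then a else 0)"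
  proof (intro pm_morphism.intro persistence_module_interval pm_morphism_axioms.intro)
    show "persistence_module (grid m 1) ?S" by unfold_locales
  qed (use \<open>k \<in> K\<close> in \<open>auto simp: linear_between_def direct_sum_def interval_module_def fun_eq_iff
      scaleB_fun_def\<close>)
  have proj: "pm_morphism (grid m 1) ?T (interval_module (J l)) (\<lambda>p f. f l)"
  proof (intro pm_morphism.intro persistence_module_interval pm_morphism_axioms.intro)
    show "persistence_module (grid m 1) ?T" by unfold_locales
    show "linear_between (spc ?T p) (spc (interval_module (J l)) p) (\<lambda>f. f l)" for p
      using \<open>l \<in> L\<close> unfolding linear_between_def image_subset_iff direct_sum_def
      by (auto simp only: scaleB_fun_def plus_fun_apply pmodule.select_convs mem_Collect_eq
          split: if_splits)
  qed (use \<open>l \<in> L\<close> in \<open>auto simp: direct_sum_def\<close>)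
  have "component \<eta> l k = (\<lambda>p. (\<lambda>f. f l) \<circ> (\<eta> p \<circ> (\<lambda>a k'. if k' = k then a else 0)))"
    by (simp add: component_def fun_eq_iff)
  then show ?thesis
    using pm_morphism_comp[OF pm_morphism_comp[OF incl assms(1)] proj] by simp
qed

theorem graphcode_GC:
  assumes "persistence_module (grid m n) M" "barcode_basis m n M \<mu>"
  shows "graphcode m n (GC m n \<mu> M)"
proof (rule graphcode.intro)
  let ?G = "GC m n \<mu> M"
  have valid: "valid_intvl m (bb_intvl \<mu> i k)" if "i \<in> {1..n}" "k \<in> {1..bb_num \<mu> i}" for i k
    using assms(2) that by (auto simp: barcode_basis_def)
  have fin: "finite (pverts (gc_graph ?G))"
  proof (rule finite_subset)
    show "pverts (gc_graph ?G) \<subseteq> Sigma {1..n} (\<lambda>i. {1..bb_num \<mu> i})"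
      by (auto simp: GC_def)
  qed simp
  moreover have arcs: "parcs (gc_graph ?G) \<subseteq> pverts (gc_graph ?G) \<times> pverts (gc_graph ?G)"
    by (auto simp: GC_def)
  ultimately show "pair_fin_digraph (gc_graph ?G)"
    by unfold_locales (auto intro: finite_subset)
  show "gc_label ?G v \<in> {1..m} \<times> {1..m + 1} \<times> {1..n}" if "v \<in> pverts (gc_graph ?G)" for v
    using that valid by (force simp: GC_def valid_intvl_def)
  show "fst (gc_intvl ?G v) < snd (gc_intvl ?G v)" if "v \<in> pverts (gc_graph ?G)" for v
    using that valid by (auto simp: GC_def valid_intvl_def gc_intvl_def)
  show "gc_height ?G w = gc_height ?G v + 1" if "(v, w) \<in> parcs (gc_graph ?G)" for v w
    using that by (auto simp: GC_def gc_height_def)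
  show "gc_intvl ?G w \<lhd>\<^sub>I gc_intvl ?G v" if vw: "(v, w) \<in> parcs (gc_graph ?G)" for v w
  proof -
    from vw obtain i k l where ikl: "v = (i, k)" "w = (Suc i, l)" "i \<in> {1..<n}"
      "k \<in> {1..bb_num \<mu> i}" "l \<in> {1..bb_num \<mu> (Suc i)}"
      "matrix_entry m (bb_intvl \<mu> i) (bb_map M \<mu> i) l k = 1"
      by (auto simp: GC_def)
    have "bb_intvl \<mu> (Suc i) l \<lhd>\<^sub>I bb_intvl \<mu> i k"
    proof (rule nonzero_interval_morphism)
      show "valid_intvl m (bb_intvl \<mu> i k)" "valid_intvl m (bb_intvl \<mu> (Suc i) l)"
        using valid ikl by auto
      show "pm_morphism (grid m 1) (interval_module (bb_intvl \<mu> i k))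
          (interval_module (bb_intvl \<mu> (Suc i) l)) (component (bb_map M \<mu> i) l k)"
        by (rule component_morphism[OF bb_map_morphism[OF assms ikl(3), unfolded bb_slice_def]
              ikl(4,5)])
      show "pm_nonzero (grid m 1) (interval_module (bb_intvl \<mu> i k)) (component (bb_map M \<mu> i) l k)"
        using ikl(6) by (auto simp: matrix_entry_def)
    qed
    then show ?thesis using ikl by (simp add: GC_def gc_intvl_def)
  qed
qed

end

theory Submission
  imports Defs
begin

text \<open>
  A module over the grid is determined, up to isomorphism, by its slices and the morphisms between
  consecutive slices, because every structure map from \<open>(x, i)\<close> to \<open>(y, j)\<close> is a horizontal map inside
  slice \<open>i\<close> followed by vertical steps in column \<open>y\<close>. So a family of slicewise isomorphisms that
  commutes with the single vertical steps is an isomorphism of two-parameter modules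
  (\<open>from_slices_isomorphism\<close>).

  The barcode basis provides such slicewise isomorphisms onto direct sums of interval modules, and
  renaming the \<open>k\<close>-th summand of slice \<open>i\<close> to the vertex \<open>(i, k)\<close> lands in the slices of the module
  induced by the graphcode. What remains is that the connecting morphism of that module, which is built
  only from the zero pattern of the components of \<open>bb_map\<close>, is \<open>bb_map\<close> after this renaming. This holds because the
  scalars form the field with two elements: there is at most one non-zero morphism between two
  interval modules, so a morphism of direct sums of intervals is recovered from the matrix that records
  which of its components vanish (\<open>interval_sum_morphism_eq_matrix_map\<close>).
\<close>

section \<open>Isomorphisms of persistence modules\<close>

lemma linear_between_sum:
  assumes "linear_between A B f" "bv.subspace A" "finite K" "\<And>k. k \<in> K \<Longrightarrow> g k \<in> A"
  shows "f (\<Sum>k\<in>K. g k) = (\<Sum>k\<in>K. f (g k))"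
  using assms(3,4)
proof (induction rule: finite_induct)
  case empty
  then show ?case
    using linear_between_zero[OF assms(1)] bv.subspace_0[OF assms(2)] by simp
next
  case (insert k K)
  then have "g k \<in> A" "(\<Sum>k\<in>K. g k) \<in> A"
    using bv.subspace_sum[OF assms(2), of K g] by auto
  then show ?case
    using assms(1) insert by (simp add: linear_between_def)
qed

lemma linear_between_subspace_image:
  assumes "linear_between A B f" "bv.subspace A"
  shows "bv.subspace (f ` A)"
proof (rule bv.subspaceI)
  show "0 \<in> f ` A"
    using linear_between_zero[OF assms(1)] bv.subspace_0[OF assms(2)] by force
  show "x + y \<in> f ` A" if "x \<in> f ` A" "y \<in> f ` A" for x y
  proof -
    from that obtain a b where ab: "a \<in> A" "b \<in> A" "x = f a" "y = f b" by blast
    then have "x + y = f (a + b)" using assms(1) by (simp add: linear_between_def)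
    then show ?thesis using bv.subspace_add[OF assms(2)] ab by blast
  qed
  show "c *\<^sub>B x \<in> f ` A" if "x \<in> f ` A" for c x
  proof -
    from that obtain a where a: "a \<in> A" "x = f a" by blast
    then have "c *\<^sub>B x = f (c *\<^sub>B a)" using assms(1) by (simp add: linear_between_def)
    then show ?thesis using bv.subspace_scale[OF assms(2)] a by blast
  qed
qed

lemma linear_between_span_image:
  assumes "linear_between (bv.span S) B f"
  shows "f ` bv.span S = bv.span (f ` S)"
proof
  show "bv.span (f ` S) \<subseteq> f ` bv.span S"
    by (rule bv.span_minimal)
      (auto intro: bv.span_base linear_between_subspace_image[OF assms bv.subspace_span])
  show "f ` bv.span S \<subseteq> bv.span (f ` S)"
  proof safe
    fix x assume "x \<in> bv.span S"
    then have "x \<in> bv.span S \<and> f x \<in> bv.span (f ` S)"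
    proof (induction rule: bv.span_induct_alt)
      case base
      then show ?case
        using linear_between_zero[OF assms] by (simp add: bv.span_zero)
    next
      case (step c x y)
      have x: "x \<in> bv.span S" "c *\<^sub>B x \<in> bv.span S"
        using step by (simp_all add: bv.span_base bv.span_scale)
      then have "f (c *\<^sub>B x + y) = c *\<^sub>B f x + f y"
        using assms step by (simp add: linear_between_def)
      then show ?case
        using step x by (simp add: bv.span_add bv.span_scale bv.span_base)
    qed
    then show "f x \<in> bv.span (f ` S)" ..
  qed
qed

text \<open>
  The axioms for \<open>N\<close> are transported along \<open>\<phi>\<close>: its spaces are images of those of \<open>M\<close>, and its structure
  maps are conjugates of those of \<open>M\<close>. In this form the lemma shows at once that a module built by hand,
  such as a direct sum or the result of \<open>from_slices\<close>, is a persistence module and which one it is.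
\<close>

lemma pm_isomorphismI:
  assumes M: "persistence_module P M"
    and lin: "\<And>p. p \<in> P \<Longrightarrow> linear_between (spc M p) (spc N p) (\<phi> p)"
    and bij: "\<And>p. p \<in> P \<Longrightarrow> bij_betw (\<phi> p) (spc M p) (spc N p)"
    and nat: "\<And>p q v. \<lbrakk>p \<in> P; q \<in> P; p \<le> q; v \<in> spc M p\<rbrakk>
      \<Longrightarrow> \<phi> q (trn M p q v) = trn N p q (\<phi> p v)"
  shows "pm_isomorphism P M N \<phi>"
proof -
  interpret M: persistence_module P M by fact
  define \<psi> where "\<psi> p = inv_into (spc M p) (\<phi> p)" for p
  have img: "spc N p = \<phi> p ` spc M p" if "p \<in> P" for p
    using bij[OF that] by (simp add: bij_betw_def)
  have \<psi>\<phi>: "\<psi> p (\<phi> p v) = v" if "p \<in> P" "v \<in> spc M p" for p v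
    using bij_betw_inv_into_left[OF bij[OF that(1)] that(2)] by (simp add: \<psi>_def)
  have \<phi>\<psi>: "\<phi> p (\<psi> p w) = w" if "p \<in> P" "w \<in> spc N p" for p w
    using bij_betw_inv_into_right[OF bij[OF that(1)] that(2)] by (simp add: \<psi>_def)
  have mem: "trn M p q v \<in> spc M q" if "p \<in> P" "q \<in> P" "p \<le> q" "v \<in> spc M p" for p q v
    using M.linear[OF that(1-3)] that(4) by (auto simp: linear_between_def)
  have trn: "trn N p q (\<phi> p v) = \<phi> q (trn M p q v)"
    if "p \<in> P" "q \<in> P" "p \<le> q" "v \<in> spc M p" for p q v
    using nat[OF that] by simp
  have add: "\<phi> p v + \<phi> p w = \<phi> p (v + w)" "v + w \<in> spc M p"
    if "p \<in> P" "v \<in> spc M p" "w \<in> spc M p" for p v w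
    using lin[OF that(1)] that bv.subspace_add[OF M.subspace] by (simp_all add: linear_between_def)
  have scale: "c *\<^sub>B \<phi> p v = \<phi> p (c *\<^sub>B v)" "c *\<^sub>B v \<in> spc M p"
    if "p \<in> P" "v \<in> spc M p" for p c v
    using lin[OF that(1)] that bv.subspace_scale[OF M.subspace] by (simp_all add: linear_between_def)
  have N: "persistence_module P N"
  proof
    show "bv.subspace (spc N p)" if "p \<in> P" for p
      using linear_between_subspace_image[OF lin M.subspace] img that by simp
    show "\<exists>B. finite B \<and> bv.span B = spc N p" if "p \<in> P" for p
    proof -
      obtain B where B: "finite B" "bv.span B = spc M p"
        using M.finite_dim[OF \<open>p \<in> P\<close>] by blast
      then have "bv.span (\<phi> p ` B) = spc N p"
        using linear_between_span_image[of B "spc N p" "\<phi> p"] lin img that by simp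
      then show ?thesis using B(1) by blast
    qed
    show "linear_between (spc N p) (spc N q) (trn N p q)" if "p \<in> P" "q \<in> P" "p \<le> q" for p q
      using M.linear[OF that] that
      by (simp add: linear_between_def img trn add scale mem image_subset_iff)
    show "trn N p p w = w" if "p \<in> P" "w \<in> spc N p" for p w
      using that by (auto simp: img trn M.trn_id)
    show "trn N q r (trn N p q w) = trn N p r w"
      if "p \<in> P" "q \<in> P" "r \<in> P" "p \<le> q" "q \<le> r" "w \<in> spc N p" for p q r w
    proof -
      have "p \<le> r" using that by order
      from that(1,6) obtain v where "v \<in> spc M p" "w = \<phi> p v" using img by blast
      then show ?thesis
        using that \<open>p \<le> r\<close> mem M.trn_comp by (simp add: trn)
    qed
  qed
  have fwd: "pm_morphism P M N \<phi>"
    by (intro pm_morphism.intro pm_morphism_axioms.intro M N lin nat)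
  have bwd: "pm_morphism P N M \<psi>"
  proof (intro pm_morphism.intro pm_morphism_axioms.intro M N)
    show "linear_between (spc N p) (spc M p) (\<psi> p)" if "p \<in> P" for p
      using that by (simp add: linear_between_def img \<psi>\<phi> add scale image_subset_iff)
    show "\<psi> q (trn N p q w) = trn M p q (\<psi> p w)"
      if "p \<in> P" "q \<in> P" "p \<le> q" "w \<in> spc N p" for p q w
      using that by (auto simp: img trn \<psi>\<phi> mem)
  qed
  show ?thesis
    using fwd bwd \<psi>\<phi> \<phi>\<psi> unfolding pm_isomorphism_def by blast
qed

lemma pm_isomorphism_bij_betw:
  assumes "pm_isomorphism P M N \<phi>" "p \<in> P"
  shows "bij_betw (\<phi> p) (spc M p) (spc N p)"
proof -
  obtain \<psi> where mor: "pm_morphism P N M \<psi>" "pm_morphism P M N \<phi>"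
    and "\<forall>v\<in>spc M p. \<psi> p (\<phi> p v) = v" "\<forall>w\<in>spc N p. \<phi> p (\<psi> p w) = w"
    using assms unfolding pm_isomorphism_def by blast
  then show ?thesis
    using mor[THEN pm_morphism.linear, OF assms(2)]
    by (intro bij_betw_byWitness[where f' = "\<psi> p"]) (auto simp: linear_between_def)
qed

lemma pm_isomorphism_comp:
  assumes "pm_isomorphism P L M \<phi>" "pm_isomorphism P M N \<psi>"
  shows "pm_isomorphism P L N (\<lambda>p. \<psi> p \<circ> \<phi> p)"
proof -
  have "pm_morphism P L M \<phi>" "pm_morphism P M N \<psi>"
    using assms by (auto simp: pm_isomorphism_def)
  then interpret c: pm_morphism P L N "\<lambda>p. \<psi> p \<circ> \<phi> p"
    by (rule pm_morphism_comp)
  have "bij_betw (\<psi> p \<circ> \<phi> p) (spc L p) (spc N p)" if "p \<in> P" for p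
    by (rule bij_betw_trans[OF pm_isomorphism_bij_betw[OF assms(1) that]
          pm_isomorphism_bij_betw[OF assms(2) that]])
  then show ?thesis
    by (intro pm_isomorphismI c.source.persistence_module_axioms c.linear c.natural)
qed

lemma pm_isomorphic_sym:
  assumes "pm_isomorphic P M N"
  shows "pm_isomorphic P N M"
  using assms unfolding pm_isomorphic_def pm_isomorphism_def by blast


section \<open>Two-parameter modules as sequences of slices\<close>

text \<open>
  Naturality along an arbitrary relation \<open>(x, i) \<le> (y, j)\<close> reduces to naturality of \<open>\<phi> i\<close> inside slice \<open>i\<close>
  and to the commuting squares of the single steps \<open>l \<rightarrow> l + 1\<close> with \<open>i \<le> l < j\<close>, pasted together by
  induction on \<open>j\<close>.
\<close>

lemma from_slices_isomorphism:
  assumes M: "persistence_module (grid m n) M"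
    and iso: "\<And>i. i \<in> {1..n} \<Longrightarrow> pm_isomorphism (grid m 1) (slice i M) (N i) (\<phi> i)"
    and sq: "\<And>i p v. \<lbrakk>i \<in> {1..<n}; p \<in> grid m 1; v \<in> spc (slice i M) p\<rbrakk>
      \<Longrightarrow> \<phi> (Suc i) p (slice_map i M p v) = \<eta> i p (\<phi> i p v)"
  shows "pm_isomorphism (grid m n) M (from_slices N \<eta>) (\<lambda>(x, i). \<phi> i (x, 1))"
proof -
  interpret M: persistence_module "grid m n" M by fact
  have mor: "pm_morphism (grid m 1) (slice i M) (N i) (\<phi> i)" if "i \<in> {1..n}" for i
    using iso[OF that] by (simp add: pm_isomorphism_def)
  have slices: "spc (slice i M) (x, 1) = spc M (x, i)"
    "trn (slice i M) (x, 1) (y, 1) = trn M (x, i) (y, i)"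
    "slice_map i M (x, 1) = trn M (x, i) (x, Suc i)" for i x y
    by (simp_all add: slice_def slice_map_def)
  have mem: "trn M p q v \<in> spc M q"
    if "p \<in> grid m n" "q \<in> grid m n" "p \<le> q" "v \<in> spc M p" for p q v
    using M.linear[OF that(1-3)] that(4) by (auto simp: linear_between_def)
  have row: "(x, 1) \<in> grid m 1" if "(x, i) \<in> grid m n" for x i :: nat
    using that by (simp add: grid_def)
  have vertical: "fold (\<lambda>l. \<eta> l (y, 1)) [i..<j] (\<phi> i (y, 1) v) = \<phi> j (y, 1) (trn M (y, i) (y, j) v)"
    if "i \<le> j" "j \<le> n" "(y, i) \<in> grid m n" "v \<in> spc M (y, i)" for y i j v
    using that(1,2)
  proof (induction j rule: dec_induct)
    case base
    then show ?case using that M.trn_id by simp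
  next
    case (step j)
    have g: "(y, j) \<in> grid m n" "(y, Suc j) \<in> grid m n" "j \<in> {1..<n}"
      using step that(3) by (auto simp: grid_def)
    have "\<phi> (Suc j) (y, 1) (slice_map j M (y, 1) (trn M (y, i) (y, j) v))
        = \<eta> j (y, 1) (\<phi> j (y, 1) (trn M (y, i) (y, j) v))"
      using mem[OF that(3) g(1) _ that(4)] step
      by (intro sq g row[OF g(1)]) (simp add: slices del: One_nat_def)
    moreover have "trn M (y, j) (y, Suc j) (trn M (y, i) (y, j) v) = trn M (y, i) (y, Suc j) v"
      using M.trn_comp[OF that(3) g(1,2)] that(4) step by simp
    ultimately show ?case using step by (simp add: slices del: One_nat_def)
  qed
  show ?thesis
  proof (intro pm_isomorphismI M; clarify)
    fix x i assume xi: "(x, i) \<in> grid m n"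
    then have i: "i \<in> {1..n}" by (simp add: grid_def)
    show "linear_between (spc M (x, i)) (spc (from_slices N \<eta>) (x, i)) (\<phi> i (x, 1))"
      using pm_morphism.linear[OF mor[OF i] row[OF xi]]
        by (simp add: slices from_slices_def del: One_nat_def)
    show "bij_betw (\<phi> i (x, 1)) (spc M (x, i)) (spc (from_slices N \<eta>) (x, i))"
      using pm_isomorphism_bij_betw[OF iso[OF i] row[OF xi]]
        by (simp add: slices from_slices_def del: One_nat_def)
    fix y j v assume yj: "(y, j) \<in> grid m n" and le: "(x, i) \<le> (y, j)" and v: "v \<in> spc M (x, i)"
    have yi: "(y, i) \<in> grid m n" "x \<le> y" "i \<le> j" "j \<le> n"
      using xi yj le by (auto simp: grid_def)
    have "\<phi> i (y, 1) (trn M (x, i) (y, i) v) = trn (N i) (x, 1) (y, 1) (\<phi> i (x, 1) v)"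
      using pm_morphism.natural[OF mor[OF i] row[OF xi] row[OF yj]] v yi
      by (simp add: slices del: One_nat_def)
    then have "trn (from_slices N \<eta>) (x, i) (y, j) (\<phi> i (x, 1) v)
        = \<phi> j (y, 1) (trn M (y, i) (y, j) (trn M (x, i) (y, i) v))"
      using vertical[OF yi(3,4,1) mem[OF xi yi(1) _ v]] yi
      by (simp add: from_slices_def del: One_nat_def)
    also have "\<dots> = \<phi> j (y, 1) (trn M (x, i) (y, j) v)"
      using M.trn_comp[OF xi yi(1) yj _ _ v] yi by simp
    finally show "\<phi> j (y, 1) (trn M (x, i) (y, j) v)
        = trn (from_slices N \<eta>) (x, i) (y, j) (\<phi> i (x, 1) v)" ..
  qed
qed


section \<open>Direct sums of interval modules\<close>

lemma mem_spc_direct_sum: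
  "f \<in> spc (direct_sum K N) p \<longleftrightarrow> (\<forall>k\<in>K. f k \<in> spc (N k) p) \<and> (\<forall>k. k \<notin> K \<longrightarrow> f k = 0)"
  by (auto simp: direct_sum_def)

text \<open>
  An element of the source is the sum of its entries, so a morphism is determined by its components;
  over the field with two elements each component is either zero or the unique non-zero morphism.
  Since matrix entries test for non-vanishing, they pick out exactly the second case.
\<close>

lemma interval_sum_morphism_eq_matrix_map:
  assumes mor: "pm_morphism (grid m 1) (direct_sum K (\<lambda>k. interval_module (I k)))
      (direct_sum L (\<lambda>l. interval_module (J l))) \<eta>"
    and fin: "finite K"
    and I: "\<And>k. k \<in> K \<Longrightarrow> valid_intvl m (I k)" and J: "\<And>l. l \<in> L \<Longrightarrow> valid_intvl m (J l)"
    and p: "p \<in> grid m 1" and f: "f \<in> spc (direct_sum K (\<lambda>k. interval_module (I k))) p"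
  shows "\<eta> p f = matrix_map K I L J (matrix_entry m I \<eta>) p f"
proof
  fix l
  let ?S = "direct_sum K (\<lambda>k. interval_module (I k))"
  let ?T = "direct_sum L (\<lambda>l. interval_module (J l))"
  interpret pm_morphism "grid m 1" ?S ?T \<eta> by (rule mor)
  have lin: "linear_between (spc ?S p) (spc ?T p) (\<eta> p)"
    by (rule linear[OF p])
  have fk: "f k \<in> spc (interval_module (I k)) p" if "k \<in> K" for k
    using f that by (simp add: mem_spc_direct_sum)
  show "\<eta> p f l = matrix_map K I L J (matrix_entry m I \<eta>) p f l"
  proof (cases "l \<in> L")
    case False
    have "\<eta> p f \<in> spc ?T p" using lin f by (auto simp: linear_between_def)
    then show ?thesis using False by (simp add: mem_spc_direct_sum matrix_map_def)
  next
    case True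
    let ?e = "\<lambda>k k'. if k' = k then f k else 0"
    have f_sum: "f = (\<Sum>k\<in>K. ?e k)"
    proof
      fix k'
      have "f k' = 0" if "k' \<notin> K" using f that by (simp add: mem_spc_direct_sum)
      moreover have "(\<Sum>k\<in>K. ?e k) k' = (\<Sum>k\<in>K. if k' = k then f k else 0)"
        using fin by (induction rule: finite_induct) simp_all
      ultimately show "f k' = (\<Sum>k\<in>K. ?e k) k'" using fin by auto
    qed
    have e: "?e k \<in> spc ?S p" if "k \<in> K" for k
      using fk[OF that] that by (auto simp: mem_spc_direct_sum interval_module_def)
    have "\<eta> p f = (\<Sum>k\<in>K. \<eta> p (?e k))"
      by (subst f_sum) (rule linear_between_sum[OF lin source.subspace[OF p] fin e])
    moreover have "(\<Sum>k\<in>K. \<eta> p (?e k)) l = (\<Sum>k\<in>K. \<eta> p (?e k) l)"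
      using fin by (induction rule: finite_induct) simp_all
    ultimately have "\<eta> p f l = (\<Sum>k\<in>K. component \<eta> l k p (f k))"
      by (simp add: component_def)
    also have "\<dots> = (\<Sum>k\<in>K. matrix_entry m I \<eta> l k * interval_one (I k) (J l) p (f k))"
    proof (rule sum.cong[OF refl])
      fix k assume k: "k \<in> K"
      show "component \<eta> l k p (f k) = matrix_entry m I \<eta> l k * interval_one (I k) (J l) p (f k)"
      proof (cases "pm_nonzero (grid m 1) (interval_module (I k)) (component \<eta> l k)")
        case nonzero: True
        then show ?thesis
          using nonzero_interval_morphism(2)[OF I[OF k] J[OF True] component_morphism[OF mor k True]
              nonzero p fk[OF k]]
          by (simp add: matrix_entry_def)
      next
        case False
        then have "component \<eta> l k p (f k) = 0"
          using p fk[OF k] unfolding pm_nonzero_def by blast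
        then show ?thesis using False by (simp add: matrix_entry_def)
      qed
    qed
    also have "\<dots> = matrix_map K I L J (matrix_entry m I \<eta>) p f l"
      using True by (simp add: matrix_map_def)
    finally show ?thesis .
  qed
qed

text \<open>
  The barcode basis numbers the summands of each slice from \<open>1\<close>, while the induced module indexes the
  summands of all slices by one vertex set; this is the change of index for slice \<open>i\<close>.
\<close>

definition to_vertices :: "nat \<Rightarrow> (nat \<Rightarrow> bit) \<Rightarrow> nat \<times> nat \<Rightarrow> bit"
  where "to_vertices i f = (\<lambda>(j, k). if j = i then f k else 0)"

lemma gc_level_GC:
  "i \<in> {1..n} \<Longrightarrow> gc_level (GC m n \<mu> M) i = Pair i ` {1..bb_num \<mu> i}"
  by (auto simp: gc_level_def GC_def gc_height_def)

lemma gc_intvl_GC: "gc_intvl (GC m n \<mu> M) (i, k) = bb_intvl \<mu> i k"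
  by (simp add: gc_intvl_def GC_def)

lemma to_vertices_isomorphism:
  assumes "persistence_module (grid m 1) (bb_slice \<mu> i)" "i \<in> {1..n}"
  shows "pm_isomorphism (grid m 1) (bb_slice \<mu> i)
    (direct_sum (gc_level (GC m n \<mu> M) i) (\<lambda>v. interval_module (gc_intvl (GC m n \<mu> M) v)))
    (\<lambda>p. to_vertices i)"
    (is "pm_isomorphism _ _ ?N _")
proof (rule pm_isomorphismI[OF assms(1)])
  note level = gc_level_GC[OF assms(2)]
  have mem: "to_vertices i f \<in> spc ?N p" if "f \<in> spc (bb_slice \<mu> i) p" for f p
    using that
    by (fastforce simp: bb_slice_def mem_spc_direct_sum level to_vertices_def gc_intvl_GC)
  show "linear_between (spc (bb_slice \<mu> i) p) (spc ?N p) (to_vertices i)" for p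
  proof -
    have "to_vertices i (f + g) = to_vertices i f + to_vertices i g"
      "to_vertices i (c *\<^sub>B f) = c *\<^sub>B to_vertices i f" for f g c
      by (auto simp: to_vertices_def scaleB_fun_def fun_eq_iff)
    then show ?thesis using mem by (simp add: linear_between_def image_subset_iff)
  qed
  have inverse: "(\<lambda>k. g (i, k)) \<in> spc (bb_slice \<mu> i) p" "to_vertices i (\<lambda>k. g (i, k)) = g"
    if g: "g \<in> spc ?N p" for g p
  proof -
    have g': "\<And>v. v \<in> Pair i ` {1..bb_num \<mu> i}
        \<Longrightarrow> g v \<in> spc (interval_module (gc_intvl (GC m n \<mu> M) v)) p"
      "\<And>v. v \<notin> Pair i ` {1..bb_num \<mu> i} \<Longrightarrow> g v = 0"
      using g unfolding mem_spc_direct_sum level by blast+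
    have "g (i, k) \<in> spc (interval_module (bb_intvl \<mu> i k)) p" if "k \<in> {1..bb_num \<mu> i}" for k
      using g'(1)[OF imageI[OF that]] by (simp only: gc_intvl_GC)
    moreover have "g (i, k) = 0" if "k \<notin> {1..bb_num \<mu> i}" for k
      by (rule g'(2)) (use that in blast)
    ultimately show "(\<lambda>k. g (i, k)) \<in> spc (bb_slice \<mu> i) p"
      unfolding bb_slice_def mem_spc_direct_sum by blast
    have "g (j, k) = 0" if "j \<noteq> i" for j k
      by (rule g'(2)) (use that in blast)
    then show "to_vertices i (\<lambda>k. g (i, k)) = g"
      by (auto simp: to_vertices_def fun_eq_iff)
  qed
  show "bij_betw (to_vertices i) (spc (bb_slice \<mu> i) p) (spc ?N p)" for p
  proof (rule bij_betw_byWitness[where f' = "\<lambda>g k. g (i, k)"])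
    show "\<forall>f\<in>spc (bb_slice \<mu> i) p. (\<lambda>k. to_vertices i f (i, k)) = f"
      by (simp add: to_vertices_def)
  qed (use mem inverse in blast)+
  show "to_vertices i (trn (bb_slice \<mu> i) p q f) = trn ?N p q (to_vertices i f)" for p q f
    by (auto simp: direct_sum_def bb_slice_def level to_vertices_def gc_intvl_GC fun_eq_iff)
qed

text \<open>
  The edges of the graphcode between heights \<open>i\<close> and \<open>i + 1\<close> are the non-zero matrix entries of \<open>bb_map\<close>,
  so the connecting morphism of the induced module is the matrix of \<open>bb_map\<close> read on vertices.
\<close>

lemma edge_matrix_map:
  assumes "i \<in> {1..<n}"
  shows "matrix_map (gc_level (GC m n \<mu> M) i) (gc_intvl (GC m n \<mu> M))
      (gc_level (GC m n \<mu> M) (Suc i)) (gc_intvl (GC m n \<mu> M))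
      (\<lambda>w v. of_bool ((v, w) \<in> parcs (gc_graph (GC m n \<mu> M)))) p (to_vertices i f)
    = to_vertices (Suc i) (matrix_map {1..bb_num \<mu> i} (bb_intvl \<mu> i)
        {1..bb_num \<mu> (Suc i)} (bb_intvl \<mu> (Suc i)) (matrix_entry m (bb_intvl \<mu> i) (bb_map M \<mu> i)) p f)"
    (is "matrix_map ?K ?I ?L ?I ?A p _ = to_vertices _ (matrix_map _ _ _ _ ?B p f)")
proof
  fix w
  have levels: "?K = Pair i ` {1..bb_num \<mu> i}" "?L = Pair (Suc i) ` {1..bb_num \<mu> (Suc i)}"
    using assms by (auto simp: gc_level_GC)
  have entry: "?A (Suc i, l) (i, k) = ?B l k"
    if "k \<in> {1..bb_num \<mu> i}" "l \<in> {1..bb_num \<mu> (Suc i)}" for k l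
    using that assms by (auto simp: GC_def matrix_entry_def)
  show "matrix_map ?K ?I ?L ?I ?A p (to_vertices i f) w
      = to_vertices (Suc i) (matrix_map {1..bb_num \<mu> i} (bb_intvl \<mu> i)
        {1..bb_num \<mu> (Suc i)} (bb_intvl \<mu> (Suc i)) ?B p f) w"
  proof (cases "w \<in> ?L")
    case False
    then show ?thesis
      by (cases w) (auto simp: matrix_map_def to_vertices_def levels)
  next
    case True
    then obtain l where l: "w = (Suc i, l)" "l \<in> {1..bb_num \<mu> (Suc i)}"
      by (auto simp: levels)
    have "matrix_map ?K ?I ?L ?I ?A p (to_vertices i f) w
        = (\<Sum>v\<in>?K. ?A w v * interval_one (?I v) (?I w) p (to_vertices i f v))"
      using True by (simp add: matrix_map_def)
    also have "\<dots> = (\<Sum>k\<in>{1..bb_num \<mu> i}.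
        ?A w (i, k) * interval_one (?I (i, k)) (?I w) p (to_vertices i f (i, k)))"
      unfolding levels by (subst sum.reindex) (simp_all add: inj_on_def)
    also have "\<dots> = (\<Sum>k\<in>{1..bb_num \<mu> i}.
        ?B l k * interval_one (bb_intvl \<mu> i k) (bb_intvl \<mu> (Suc i) l) p (f k))"
    proof (rule sum.cong[OF refl])
      fix k assume k: "k \<in> {1..bb_num \<mu> i}"
      show "?A w (i, k) * interval_one (?I (i, k)) (?I w) p (to_vertices i f (i, k))
          = ?B l k * interval_one (bb_intvl \<mu> i k) (bb_intvl \<mu> (Suc i) l) p (f k)"
        unfolding l(1) entry[OF k l(2)] gc_intvl_GC by (simp add: to_vertices_def)
    qed
    finally show ?thesis
      using l by (simp add: matrix_map_def to_vertices_def)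
  qed
qed


section \<open>The module induced by the graphcode of a barcode basis\<close>

theorem proposition4:
  fixes m n :: nat
    and M :: "(nat \<times> nat, 'a::bit_vector_space) pmodule"
    and \<mu> :: "'a barcode_basis"
  assumes "persistence_module (grid m n) M"
    and "barcode_basis m n M \<mu>"
  shows "pm_isomorphic (grid m n) (PM (GC m n \<mu> M)) M"
proof -
  let ?G = "GC m n \<mu> M"
  have iso: "pm_isomorphism (grid m 1) (slice i M) (bb_slice \<mu> i) (bb_iso \<mu> i)"
    and valid: "\<And>k. k \<in> {1..bb_num \<mu> i} \<Longrightarrow> valid_intvl m (bb_intvl \<mu> i k)"
    if "i \<in> {1..n}" for i
    using assms(2) that by (auto simp: barcode_basis_def)
  have mor: "pm_morphism (grid m 1) (slice i M) (bb_slice \<mu> i) (bb_iso \<mu> i)" if "i \<in> {1..n}" for i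
    using iso[OF that] by (simp add: pm_isomorphism_def)
  have "pm_isomorphism (grid m n) M (PM ?G) (\<lambda>(x, i). to_vertices i \<circ> bb_iso \<mu> i (x, 1))"
    unfolding PM_def
  proof (rule from_slices_isomorphism[where \<phi> = "\<lambda>i p. to_vertices i \<circ> bb_iso \<mu> i p", OF assms(1)])
    show "pm_isomorphism (grid m 1) (slice i M)
        (direct_sum (gc_level ?G i) (\<lambda>v. interval_module (gc_intvl ?G v)))
        (\<lambda>p. to_vertices i \<circ> bb_iso \<mu> i p)" if "i \<in> {1..n}" for i
    proof (rule pm_isomorphism_comp[OF iso[OF that]])
      interpret pm_morphism "grid m 1" "slice i M" "bb_slice \<mu> i" "bb_iso \<mu> i"
        by (rule mor[OF that])
      show "pm_isomorphism (grid m 1) (bb_slice \<mu> i)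
          (direct_sum (gc_level ?G i) (\<lambda>v. interval_module (gc_intvl ?G v))) (\<lambda>p. to_vertices i)"
        by (rule to_vertices_isomorphism[OF target.persistence_module_axioms that])
    qed
  next
    fix i p v assume i: "i \<in> {1..<n}" and p: "p \<in> grid m 1" and v: "v \<in> spc (slice i M) p"
    then have i': "i \<in> {1..n}" "Suc i \<in> {1..n}" by auto
    let ?f = "bb_iso \<mu> i p v"
    have f: "?f \<in> spc (bb_slice \<mu> i) p"
      using pm_morphism.linear[OF mor[OF i'(1)] p] v by (auto simp: linear_between_def)
    have "bb_iso \<mu> (Suc i) p (slice_map i M p v) = bb_map M \<mu> i p ?f"
      using pm_isomorphism_bij_betw[OF iso[OF i'(1)] p] v
      by (simp add: bb_map_def bij_betw_inv_into_left)
    also have "\<dots> = matrix_map {1..bb_num \<mu> i} (bb_intvl \<mu> i)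
        {1..bb_num \<mu> (Suc i)} (bb_intvl \<mu> (Suc i)) (matrix_entry m (bb_intvl \<mu> i) (bb_map M \<mu> i)) p ?f"
      using bb_map_morphism[OF assms i] f valid i' p
      by (intro interval_sum_morphism_eq_matrix_map) (simp_all add: bb_slice_def)
    finally show "(to_vertices (Suc i) \<circ> bb_iso \<mu> (Suc i) p) (slice_map i M p v)
        = matrix_map (gc_level ?G i) (gc_intvl ?G) (gc_level ?G (Suc i)) (gc_intvl ?G)
            (\<lambda>w v. of_bool ((v, w) \<in> parcs (gc_graph ?G))) p ((to_vertices i \<circ> bb_iso \<mu> i p) v)"
      by (simp only: o_apply edge_matrix_map[OF i])
  qed
  then show ?thesis
    by (intro pm_isomorphic_sym[of _ M]) (auto simp: pm_isomorphic_def)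
qed

end
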